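(* Let $(X,\|\cdot\|)$ be a complex normed space and let $[\cdot,\cdot]$ be a semi-inner product in $X$ (generating the norm). Regarding $\perp_{\rho_\infty}$ and $\perp_s$ as binary relations on $X$, the following conditions are equivalent: (i) $\perp_{\rho_\infty}=\perp_s$; (ii) $\perp_{\rho_\infty}\subseteq\perp_s$; (iii) $\perp_{\rho_\infty}\supseteq\perp_s$; (iv) $\rho_\infty(x,y)=\overline{[y,x]}$ for all $x,y\in X$.
   Context: For a complex normed space $X$ and $x,y\in X$, the right norm derivative is $\rho_{+}(x,y)=\lim_{t\to0^{+}}\frac{\|x+ty\|^2-\|x\|^2}{2t}\in\mathbb{R}$, and $$\rho_{\infty}(x,y)=\frac1\pi\int_0^{2\pi}e^{i\theta}\rho_{+}(x,e^{i\theta}y)\,d\theta\in\mathbb{C}.$$ A semi-inner product in $X$ generating the norm is a map $[\cdot,\cdot]:X\times X\to\mathbb{C}$ such that for all $x,y,z\in X$, $\alpha\in\mathbb{C}$: $[\alpha x+y,z]=\alpha[x,z]+[y,z]$; $[x,\alpha y]=\overline{\alpha}[x,y]$; $[x,x]=\|x\|^2$; $|[x,y]|\le\|x\|\|y\|$. The relations are: $x\perp_{\rho_\infty}y$ iff $\rho_\infty(x,y)=0$; $x\perp_s y$ iff $[y,x]=0$ (note the order). *)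

theory Defs
  imports "HOL-Analysis.Analysis"
begin

text \<open>The inherited real scalar multiplication is the restriction of the complex one, so limits
  and norms are those of the underlying real normed space; completeness is not assumed.\<close>

class complex_normed_vector = real_normed_vector +
  fixes scaleC :: "complex \<Rightarrow> 'a \<Rightarrow> 'a" (infixr "*\<^sub>C" 75)
  assumes scaleC_add_right: "a *\<^sub>C (x + y) = a *\<^sub>C x + a *\<^sub>C y"
    and scaleC_add_left: "(a + b) *\<^sub>C x = a *\<^sub>C x + b *\<^sub>C x"
    and scaleC_scaleC: "a *\<^sub>C (b *\<^sub>C x) = (a * b) *\<^sub>C x"
    and scaleC_one: "1 *\<^sub>C x = x"
    and scaleR_scaleC: "r *\<^sub>R x = complex_of_real r *\<^sub>C x"
    and norm_scaleC: "norm (a *\<^sub>C x) = cmod a * norm x"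

text \<open>The limit always exists, by convexity of the norm, so \<open>Lim\<close> denotes a genuine limit.\<close>

definition rho_plus :: "'a::real_normed_vector \<Rightarrow> 'a \<Rightarrow> real" where
  "rho_plus x y = Lim (at_right 0) (\<lambda>t. ((norm (x + t *\<^sub>R y))\<^sup>2 - (norm x)\<^sup>2) / (2 * t))"

text \<open>The integrand is continuous in \<open>\<theta>\<close>, since \<open>rho_plus x\<close> is Lipschitz.\<close>

definition rho_infty :: "'a::complex_normed_vector \<Rightarrow> 'a \<Rightarrow> complex" where
  "rho_infty x y = complex_of_real (1 / pi) *
     integral {0..2 * pi} (\<lambda>\<theta>. cis \<theta> * complex_of_real (rho_plus x (cis \<theta> *\<^sub>C y)))"

definition semi_inner_product :: "('a::complex_normed_vector \<Rightarrow> 'a \<Rightarrow> complex) \<Rightarrow> bool" where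
  "semi_inner_product s \<longleftrightarrow>
     (\<forall>\<alpha> x y z. s (\<alpha> *\<^sub>C x + y) z = \<alpha> * s x z + s y z) \<and>
     (\<forall>\<alpha> x y. s x (\<alpha> *\<^sub>C y) = cnj \<alpha> * s x y) \<and>
     (\<forall>x. s x x = complex_of_real ((norm x)\<^sup>2)) \<and>
     (\<forall>x y. cmod (s x y) \<le> norm x * norm y)"

definition perp_rho_infty :: "('a::complex_normed_vector) rel" where
  "perp_rho_infty = {(x, y). rho_infty x y = 0}"

text \<open>Note the order: \<open>x\<close> is \<open>s\<close>-orthogonal to \<open>y\<close> when \<open>s y x = 0\<close>.\<close>

definition perp_sip :: "('a::complex_normed_vector \<Rightarrow> 'a \<Rightarrow> complex) \<Rightarrow> 'a rel" where
  "perp_sip s = {(x, y). s y x = 0}"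

end

theory Submission
  imports Defs
begin

text \<open>For fixed \<open>x\<close>, the map \<open>rho_plus x\<close> is sublinear and odd on the complex line through \<open>x\<close>,
  where it equals \<open>\<alpha> *\<^sub>C x \<mapsto> Re \<alpha> * (norm x)\<^sup>2\<close>; hence it is additive along that line. Integrating,
  \<open>rho_infty x (\<alpha> *\<^sub>C x + y) = cnj \<alpha> * (norm x)\<^sup>2 + rho_infty x y\<close>, which is exactly the identity
  satisfied by \<open>cnj (s y x)\<close>. Either functional vanishes at exactly one point of each affine line
  \<open>y + \<complex> x\<close> (for \<open>x \<noteq> 0\<close>) and is determined by that point, so an inclusion between the two
  relations already forces the functionals to agree.\<close>

subsection \<open>The right norm derivative\<close>

lemma power2_convex:
  fixes a b u :: real
  assumes "0 \<le> u" "u \<le> 1"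
  shows "(u * a + (1 - u) * b)\<^sup>2 \<le> u * a\<^sup>2 + (1 - u) * b\<^sup>2"
proof -
  have "u * a\<^sup>2 + (1 - u) * b\<^sup>2 - (u * a + (1 - u) * b)\<^sup>2 = u * (1 - u) * (a - b)\<^sup>2"
    by (simp add: power2_eq_square algebra_simps)
  also have "\<dots> \<ge> 0"
    using assms by simp
  finally show ?thesis by simp
qed

lemma norm_convex_comb_power2:
  fixes v w :: "'a::real_normed_vector"
  assumes "0 \<le> u" "u \<le> 1"
  shows "(norm (u *\<^sub>R v + (1 - u) *\<^sub>R w))\<^sup>2 \<le> u * (norm v)\<^sup>2 + (1 - u) * (norm w)\<^sup>2"
proof -
  have "norm (u *\<^sub>R v + (1 - u) *\<^sub>R w) \<le> u * norm v + (1 - u) * norm w"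
    using norm_triangle_ineq[of "u *\<^sub>R v" "(1 - u) *\<^sub>R w"] assms by simp
  then have "(norm (u *\<^sub>R v + (1 - u) *\<^sub>R w))\<^sup>2 \<le> (u * norm v + (1 - u) * norm w)\<^sup>2"
    by (rule power_mono) simp
  also have "\<dots> \<le> u * (norm v)\<^sup>2 + (1 - u) * (norm w)\<^sup>2"
    by (rule power2_convex[OF assms])
  finally show ?thesis .
qed

text \<open>Slope between 0 and \<open>t\<close> of the convex function taking \<open>t\<close> to
  half the squared norm of \<open>x + t *\<^sub>R y\<close>.\<close>

definition norm_quot :: "'a::real_normed_vector \<Rightarrow> 'a \<Rightarrow> real \<Rightarrow> real" where
  "norm_quot x y t = ((norm (x + t *\<^sub>R y))\<^sup>2 - (norm x)\<^sup>2) / (2 * t)"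

text \<open>Slopes of a convex function from a fixed base point increase:
  \<open>x + a *\<^sub>R y\<close> is a convex combination of \<open>x + b *\<^sub>R y\<close> and
  \<open>x\<close> with weight \<open>a / b\<close>.\<close>

lemma norm_quot_mono:
  assumes "0 < a" "a \<le> b"
  shows "norm_quot x y a \<le> norm_quot x y b"
proof -
  define u where "u = a / b"
  have u: "0 \<le> u" "u \<le> 1" and a: "a = u * b"
    using assms by (auto simp: u_def)
  have "x + a *\<^sub>R y = u *\<^sub>R (x + b *\<^sub>R y) + (1 - u) *\<^sub>R x"
    by (simp add: a algebra_simps)
  then have "(norm (x + a *\<^sub>R y))\<^sup>2 \<le> u * (norm (x + b *\<^sub>R y))\<^sup>2 + (1 - u) * (norm x)\<^sup>2"
    using norm_convex_comb_power2[OF u, of "x + b *\<^sub>R y" x] by simp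
  then have "(norm (x + a *\<^sub>R y))\<^sup>2 - (norm x)\<^sup>2 \<le> u * ((norm (x + b *\<^sub>R y))\<^sup>2 - (norm x)\<^sup>2)"
    by (simp add: algebra_simps)
  then have "norm_quot x y a \<le> u * ((norm (x + b *\<^sub>R y))\<^sup>2 - (norm x)\<^sup>2) / (2 * a)"
    unfolding norm_quot_def using assms by (intro divide_right_mono) auto
  also have "\<dots> = norm_quot x y b"
    using assms by (simp add: norm_quot_def u_def)
  finally show ?thesis .
qed

text \<open>Being independent of \<open>t\<close>, this bound makes the infimum of the quotients
  over \<open>t > 0\<close> finite.\<close>

lemma norm_quot_lower:
  assumes "0 < t"
  shows "- (norm x * norm y) \<le> norm_quot x y t"
proof -
  have "norm x \<le> norm (x + t *\<^sub>R y) + t * norm y"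
    using norm_triangle_ineq4[of "x + t *\<^sub>R y" "t *\<^sub>R y"] assms by simp
  \<comment> \<open>The triangle inequality can be squared only when
    \<open>norm x - t * norm y\<close> is nonnegative; otherwise the left side here is already at
    most 0.\<close>
  then have "(norm x)\<^sup>2 - 2 * t * (norm x * norm y) \<le> (norm (x + t *\<^sub>R y))\<^sup>2"
  proof (cases "t * norm y \<le> norm x")
    case True
    with \<open>norm x \<le> _\<close> have "(norm x - t * norm y)\<^sup>2 \<le> (norm (x + t *\<^sub>R y))\<^sup>2"
      by (intro power_mono) auto
    moreover have "(norm x - t * norm y)\<^sup>2 = (norm x)\<^sup>2 - 2 * t * (norm x * norm y) + (t * norm y)\<^sup>2"
      by (simp add: power2_eq_square algebra_simps)
    ultimately show ?thesis
      by (smt (verit) zero_le_power2)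
  next
    case False
    then have "norm x * norm x \<le> norm x * (t * norm y)"
      by (intro mult_left_mono) auto
    then have "(norm x)\<^sup>2 - 2 * t * (norm x * norm y) \<le> - (norm x * (t * norm y))"
      by (simp add: power2_eq_square algebra_simps)
    also have "\<dots> \<le> 0" using assms by simp
    also have "\<dots> \<le> (norm (x + t *\<^sub>R y))\<^sup>2" by simp
    finally show ?thesis .
  qed
  then show ?thesis
    using assms by (simp add: norm_quot_def field_simps)
qed

lemma norm_quot_upper:
  assumes "0 < t"
  shows "norm_quot x y t \<le> norm x * norm y + t * (norm y)\<^sup>2 / 2"
proof -
  have "norm (x + t *\<^sub>R y) \<le> norm x + t * norm y"
    using norm_triangle_ineq[of x "t *\<^sub>R y"] assms by simp
  then have "(norm (x + t *\<^sub>R y))\<^sup>2 \<le> (norm x + t * norm y)\<^sup>2"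
    by (rule power_mono) simp
  then show ?thesis
    using assms by (simp add: norm_quot_def field_simps power2_eq_square)
qed

section \<open>Existence, subadditivity and continuity of the right derivative\<close>

lemma rho_plus_eqI:
  assumes "(norm_quot x y \<longlongrightarrow> l) (at_right 0)"
  shows "rho_plus x y = l"
  using assms unfolding rho_plus_def norm_quot_def
  by (intro tendsto_Lim) simp_all

text \<open>An increasing function bounded below on the positive reals tends to its infimum at 0
  from the right. Uniqueness of limits identifies that infimum with
  \<open>rho_plus x y\<close>.\<close>

lemma rho_plus_tendsto: "(norm_quot x y \<longlongrightarrow> rho_plus x y) (at_right 0)"
proof -
  have "(norm_quot x y \<longlongrightarrow> Inf (norm_quot x y ` ({0<..} \<inter> UNIV))) (at 0 within ({0<..} \<inter> UNIV))"
    by (rule Lim_right_bound[where K = "- (norm x * norm y)"])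
      (auto intro: norm_quot_mono norm_quot_lower)
  then show ?thesis
    using rho_plus_eqI by force
qed

lemma rho_plus_le: "rho_plus x y \<le> norm x * norm y"
proof (rule tendsto_le[OF _ _ rho_plus_tendsto])
  have "((\<lambda>t. norm x * norm y + t * (norm y)\<^sup>2 / 2) \<longlongrightarrow> norm x * norm y + 0 * (norm y)\<^sup>2 / 2)
    (at_right 0)"
    by (intro tendsto_intros) simp
  then show "((\<lambda>t. norm x * norm y + t * (norm y)\<^sup>2 / 2) \<longlongrightarrow> norm x * norm y) (at_right 0)"
    by simp
  show "\<forall>\<^sub>F t in at_right 0. norm_quot x y t \<le> norm x * norm y + t * (norm y)\<^sup>2 / 2"
    using eventually_at_right_less[of 0] by eventually_elim (rule norm_quot_upper)
qed simp

text \<open>Midpoint convexity: \<open>x + t *\<^sub>R (y + z)\<close> is the midpoint of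
  \<open>x + (2 * t) *\<^sub>R y\<close> and \<open>x + (2 * t) *\<^sub>R z\<close>, so the
  quotients on the right are taken at \<open>2 * t\<close>.\<close>

lemma rho_plus_add_le: "rho_plus x (y + z) \<le> rho_plus x y + rho_plus x z"
proof (rule tendsto_le[OF _ _ rho_plus_tendsto])
  have lim: "((\<lambda>t. norm_quot x v (2 * t)) \<longlongrightarrow> rho_plus x v) (at_right 0)" for v
  proof (rule filterlim_compose[OF rho_plus_tendsto])
    have "((\<lambda>t::real. 2 * t) \<longlongrightarrow> 2 * 0) (at_right 0)"
      by (intro tendsto_intros)
    then show "filterlim (\<lambda>t::real. 2 * t) (at_right 0) (at_right 0)"
      using eventually_at_right_less[of "0::real"]
      by (auto simp: filterlim_at elim: eventually_mono)
  qed
  show "((\<lambda>t. norm_quot x y (2 * t) + norm_quot x z (2 * t))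
      \<longlongrightarrow> rho_plus x y + rho_plus x z) (at_right 0)"
    by (intro tendsto_add lim)
  show "\<forall>\<^sub>F t in at_right 0. norm_quot x (y + z) t \<le> norm_quot x y (2 * t) + norm_quot x z (2 * t)"
    using eventually_at_right_less[of 0]
  proof eventually_elim
    case (elim t)
    have "x = (1/2) *\<^sub>R x + (1/2) *\<^sub>R x"
      by (simp flip: scaleR_add_left)
    then have "x + t *\<^sub>R (y + z)
        = (1/2) *\<^sub>R (x + (2 * t) *\<^sub>R y) + (1 - 1/2) *\<^sub>R (x + (2 * t) *\<^sub>R z)"
      by (simp add: scaleR_add_right add_ac del: scaleR_half_double)
    then have "(norm (x + t *\<^sub>R (y + z)))\<^sup>2
        \<le> (1/2) * (norm (x + (2 * t) *\<^sub>R y))\<^sup>2 + (1 - 1/2) * (norm (x + (2 * t) *\<^sub>R z))\<^sup>2"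
      using norm_convex_comb_power2[of "1/2" "x + (2 * t) *\<^sub>R y" "x + (2 * t) *\<^sub>R z"] by simp
    then have "norm_quot x (y + z) t \<le> ((1/2) * (norm (x + (2 * t) *\<^sub>R y))\<^sup>2
        + (1 - 1/2) * (norm (x + (2 * t) *\<^sub>R z))\<^sup>2 - (norm x)\<^sup>2) / (2 * t)"
      unfolding norm_quot_def using elim by (intro divide_right_mono) auto
    also have "\<dots> = norm_quot x y (2 * t) + norm_quot x z (2 * t)"
      using elim by (simp add: norm_quot_def field_simps)
    finally show ?case .
  qed
qed simp

text \<open>Subadditivity applied to \<open>y = z + (y - z)\<close> and to
  \<open>z = y + (z - y)\<close> bounds the difference from both sides.\<close>

lemma rho_plus_lipschitz: "\<bar>rho_plus x y - rho_plus x z\<bar> \<le> norm x * norm (y - z)"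
  using rho_plus_add_le[of x z "y - z"] rho_plus_add_le[of x y "z - y"]
    rho_plus_le[of x "y - z"] rho_plus_le[of x "z - y"]
  by (simp add: norm_minus_commute abs_le_iff)

lemma continuous_on_rho_plus: "continuous_on UNIV (rho_plus x)"
proof (rule lipschitz_on_continuous_on)
  show "(norm x)-lipschitz_on UNIV (rho_plus x)"
    by (rule lipschitz_onI) (auto simp: dist_norm rho_plus_lipschitz)
qed

section \<open>Values along the complex line through the base point\<close>

text \<open>Here the quotient is explicit, since
  \<open>x + t *\<^sub>R (\<alpha> *\<^sub>C x)\<close> is the multiple of \<open>x\<close> by
  \<open>1 + t * \<alpha>\<close>; it differs from the limit by a term linear in
  \<open>t\<close>.\<close>

lemma rho_plus_self:
  fixes x :: "'a::complex_normed_vector"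
  shows "rho_plus x (\<alpha> *\<^sub>C x) = Re \<alpha> * (norm x)\<^sup>2"
proof (rule rho_plus_eqI)
  have "((\<lambda>t. (Re \<alpha> + t * (cmod \<alpha>)\<^sup>2 / 2) * (norm x)\<^sup>2)
      \<longlongrightarrow> (Re \<alpha> + 0 * (cmod \<alpha>)\<^sup>2 / 2) * (norm x)\<^sup>2) (at_right 0)"
    by (intro tendsto_intros) simp
  moreover have "\<forall>\<^sub>F t in at_right 0.
      (Re \<alpha> + t * (cmod \<alpha>)\<^sup>2 / 2) * (norm x)\<^sup>2 = norm_quot x (\<alpha> *\<^sub>C x) t"
    using eventually_at_right_less[of 0]
  proof eventually_elim
    case (elim t)
    have "x + t *\<^sub>R (\<alpha> *\<^sub>C x) = (1 + t * \<alpha>) *\<^sub>C x"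
      by (simp add: scaleR_scaleC scaleC_scaleC scaleC_add_left scaleC_one)
    then have "(norm (x + t *\<^sub>R (\<alpha> *\<^sub>C x)))\<^sup>2 = (cmod (1 + t * \<alpha>))\<^sup>2 * (norm x)\<^sup>2"
      by (simp add: norm_scaleC power_mult_distrib)
    also have "(cmod (1 + t * \<alpha>))\<^sup>2 = 1 + 2 * t * Re \<alpha> + t\<^sup>2 * (cmod \<alpha>)\<^sup>2"
      by (simp add: cmod_power2) (simp add: power2_eq_square algebra_simps)
    finally show ?case
      using elim by (simp add: norm_quot_def field_simps power2_eq_square)
  qed
  ultimately show "(norm_quot x (\<alpha> *\<^sub>C x) \<longlongrightarrow> Re \<alpha> * (norm x)\<^sup>2) (at_right 0)"
    by (simp add: tendsto_cong)
qed

text \<open>Subadditivity gives one inequality directly and the other after cancelling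
  \<open>\<alpha> *\<^sub>C x\<close>. The two bounds coincide because \<open>rho_plus x\<close> is
  odd on multiples of \<open>x\<close>.\<close>

lemma rho_plus_add_self:
  fixes x :: "'a::complex_normed_vector"
  shows "rho_plus x (\<alpha> *\<^sub>C x + y) = Re \<alpha> * (norm x)\<^sup>2 + rho_plus x y"
proof -
  have "(-\<alpha>) *\<^sub>C x + (\<alpha> *\<^sub>C x + y) = ((-\<alpha>) + \<alpha>) *\<^sub>C x + y"
    by (simp only: scaleC_add_left add.assoc)
  also have "\<dots> = y"
    using scaleR_scaleC[of 0 x] by simp
  finally have "rho_plus x y \<le> rho_plus x ((-\<alpha>) *\<^sub>C x) + rho_plus x (\<alpha> *\<^sub>C x + y)"
    using rho_plus_add_le by metis
  then show ?thesis
    using rho_plus_add_le[of x "\<alpha> *\<^sub>C x" y] by (simp add: rho_plus_self)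
qed

subsection \<open>Averaging over the circle\<close>

text \<open>The integrand is \<open>(cis (2 * \<theta>) * \<alpha> + cnj \<alpha>) / 2\<close>. The
  oscillating part integrates to 0 over the full circle and the constant part leaves
  \<open>pi * cnj \<alpha>\<close>, which explains the factor \<open>1 / pi\<close> in
  \<open>rho_infty\<close>.\<close>

lemma has_integral_cis_Re:
  "((\<lambda>\<theta>. cis \<theta> * complex_of_real (Re (cis \<theta> * \<alpha>))) has_integral pi * cnj \<alpha>) {0..2 * pi}"
proof -
  define F where "F \<theta> = (- \<i> * cis (2 * \<theta>) * \<alpha> / 2 + \<theta> * cnj \<alpha>) / 2" for \<theta> :: real
  have "((\<lambda>\<theta>. cis \<theta> * complex_of_real (Re (cis \<theta> * \<alpha>))) has_integral F (2 * pi) - F 0) {0..2 * pi}"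
  proof (rule fundamental_theorem_of_calculus)
    fix \<theta> :: real
    have "(F has_vector_derivative (cis (2 * \<theta>) * \<alpha> + cnj \<alpha>) / 2) (at \<theta> within {0..2 * pi})"
      unfolding F_def has_vector_derivative_def
      by (rule derivative_eq_intros refl | simp)+
        (auto simp: fun_eq_iff scaleR_conv_of_real field_simps)
    also have "(cis (2 * \<theta>) * \<alpha> + cnj \<alpha>) / 2 = cis \<theta> * complex_of_real (Re (cis \<theta> * \<alpha>))"
    proof -
      have "complex_of_real (Re (cis \<theta> * \<alpha>)) = (cis \<theta> * \<alpha> + cis (- \<theta>) * cnj \<alpha>) / 2"
        using complex_add_cnj[of "cis \<theta> * \<alpha>"] by (simp add: cis_cnj)
      moreover have "cis \<theta> * (cis \<theta> * \<alpha>) = cis (2 * \<theta>) * \<alpha>"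
        by (simp add: cis_mult flip: mult.assoc)
      moreover have "cis \<theta> * (cis (- \<theta>) * cnj \<alpha>) = cnj \<alpha>"
        by (simp add: cis_mult flip: mult.assoc)
      ultimately show ?thesis
        by (simp only: times_divide_eq_right distrib_left)
    qed
    finally show "(F has_vector_derivative cis \<theta> * complex_of_real (Re (cis \<theta> * \<alpha>)))
      (at \<theta> within {0..2 * pi})" .
  qed simp
  moreover have "F (2 * pi) - F 0 = pi * cnj \<alpha>"
  proof -
    have "cis (2 * (2 * pi)) = 1"
      using cis_multiple_2pi[of 2] by (simp add: mult.commute)
    then show ?thesis
      by (simp add: F_def field_simps)
  qed
  ultimately show ?thesis by simp
qed

lemma rho_infty_add_self:
  "rho_infty x (\<alpha> *\<^sub>C x + y) = cnj \<alpha> * (norm x)\<^sup>2 + rho_infty x y"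
proof -
  define f where "f \<theta> = cis \<theta> * complex_of_real (rho_plus x (cis \<theta> *\<^sub>C y))" for \<theta>
  define g where "g \<theta> = cis \<theta> * complex_of_real (Re (cis \<theta> * \<alpha>)) * (norm x)\<^sup>2" for \<theta>
  \<comment> \<open>Continuity of scaling in the scalar makes \<open>f\<close> continuous, hence
    integrable, so that the integral of \<open>g + f\<close> may be split.\<close>
  have "norm (a *\<^sub>C y - b *\<^sub>C y) = norm y * dist a b" for a b
  proof -
    have "a *\<^sub>C y = (a - b) *\<^sub>C y + b *\<^sub>C y"
      by (simp flip: scaleC_add_left)
    then show ?thesis
      by (simp add: norm_scaleC dist_norm)
  qed
  then have "(norm y)-lipschitz_on UNIV (\<lambda>w. w *\<^sub>C y)"
    by (intro lipschitz_onI) (auto simp: dist_norm)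
  then have "continuous_on UNIV (\<lambda>w. w *\<^sub>C y)"
    by (rule lipschitz_on_continuous_on)
  then have "continuous_on {0..2 * pi} (\<lambda>\<theta>. cis \<theta> *\<^sub>C y)"
    by (rule continuous_on_compose2) (auto intro!: continuous_intros)
  then have "continuous_on {0..2 * pi} (\<lambda>\<theta>. rho_plus x (cis \<theta> *\<^sub>C y))"
    by (rule continuous_on_compose2[OF continuous_on_rho_plus]) simp
  then have "continuous_on {0..2 * pi} f"
    unfolding f_def by (intro continuous_intros)
  then have f: "f integrable_on {0..2 * pi}"
    by (rule integrable_continuous_real)
  have g: "(g has_integral pi * cnj \<alpha> * (norm x)\<^sup>2) {0..2 * pi}"
    unfolding g_def by (intro has_integral_mult_left has_integral_cis_Re)
  \<comment> \<open>At each angle the rotated vector is \<open>(cis \<theta> * \<alpha>) *\<^sub>C x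
    + cis \<theta> *\<^sub>C y\<close>, so the multiple of \<open>x\<close> splits off
    additively.\<close>
  have "cis \<theta> * complex_of_real (rho_plus x (cis \<theta> *\<^sub>C (\<alpha> *\<^sub>C x + y))) = g \<theta> + f \<theta>" for \<theta>
    unfolding f_def g_def scaleC_add_right scaleC_scaleC rho_plus_add_self
    by (simp add: algebra_simps)
  then have "integral {0..2 * pi}
      (\<lambda>\<theta>. cis \<theta> * complex_of_real (rho_plus x (cis \<theta> *\<^sub>C (\<alpha> *\<^sub>C x + y))))
      = pi * cnj \<alpha> * (norm x)\<^sup>2 + integral {0..2 * pi} f"
    using f g by (simp add: integral_add has_integral_integrable integral_unique)
  then show ?thesis
    by (simp add: rho_infty_def f_def[abs_def] field_simps)
qed

text \<open>Settles the degenerate case where the line through \<open>y\<close> in direction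
  \<open>x\<close> collapses to a point. The Lipschitz constant of \<open>rho_plus 0\<close> is 0,
  so this function is constant.\<close>

lemma rho_infty_zero_left: "rho_infty 0 y = 0"
proof -
  have "rho_plus 0 z = 0" for z :: 'a
    using rho_plus_lipschitz[of 0 z 0] rho_plus_self[of "0 :: 'a" 0] scaleR_scaleC[of 0 "0 :: 'a"]
    by simp
  then show ?thesis
    by (simp add: rho_infty_def)
qed

section \<open>Comparison of the zeros of the two functionals\<close>

theorem theorem3p3:
  fixes s :: "'a::complex_normed_vector \<Rightarrow> 'a \<Rightarrow> complex"
  assumes "semi_inner_product s"
  shows "((perp_rho_infty :: 'a rel) = perp_sip s \<longleftrightarrow> (perp_rho_infty :: 'a rel) \<subseteq> perp_sip s) \<and>
    ((perp_rho_infty :: 'a rel) \<subseteq> perp_sip s \<longleftrightarrow> (perp_rho_infty :: 'a rel) \<supseteq> perp_sip s) \<and>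
    ((perp_rho_infty :: 'a rel) \<supseteq> perp_sip s \<longleftrightarrow> (\<forall>x y. rho_infty x y = cnj (s y x)))"
proof -
  have s_add_self: "s (\<alpha> *\<^sub>C x + y) x = \<alpha> * (norm x)\<^sup>2 + s y x" for \<alpha> x y
    using assms by (simp add: semi_inner_product_def)
  have s_zero: "s y 0 = 0" for y
  proof -
    have "cmod (s y 0) \<le> norm y * norm (0 :: 'a)"
      using assms unfolding semi_inner_product_def by blast
    then show ?thesis by simp
  qed
  \<comment> \<open>By the two translation identities, a common zero \<open>\<alpha>\<close> fixes
    both values, as \<open>- cnj \<alpha> * (norm x)\<^sup>2\<close> and
    \<open>- \<alpha> * (norm x)\<^sup>2\<close>, which are conjugate.\<close>
  have eq: "rho_infty x y = cnj (s y x)"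
    if common: "\<exists>\<alpha>. rho_infty x (\<alpha> *\<^sub>C x + y) = 0 \<and> s (\<alpha> *\<^sub>C x + y) x = 0" for x y
  proof -
    from common obtain \<alpha> where "cnj \<alpha> * (norm x)\<^sup>2 + rho_infty x y = 0"
      and "\<alpha> * (norm x)\<^sup>2 + s y x = 0"
      by (auto simp: rho_infty_add_self s_add_self)
    then have "rho_infty x y = - (cnj \<alpha> * (norm x)\<^sup>2)" "s y x = - (\<alpha> * (norm x)\<^sup>2)"
      by (simp_all add: eq_neg_iff_add_eq_0 add.commute)
    then show ?thesis by simp
  qed
  have sub: "\<forall>x y. rho_infty x y = cnj (s y x)" if "perp_rho_infty \<subseteq> perp_sip s"
  proof (intro allI)
    fix x y :: 'a
    show "rho_infty x y = cnj (s y x)"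
    proof (cases "x = 0")
      case False
      \<comment> \<open>This solves
        \<open>cnj \<alpha> * (norm x)\<^sup>2 + rho_infty x y = 0\<close>; the assumed inclusion
        makes the same point a zero of \<open>s\<close>.\<close>
      define \<alpha> where "\<alpha> = - cnj (rho_infty x y) / (norm x)\<^sup>2"
      have "rho_infty x (\<alpha> *\<^sub>C x + y) = 0"
        using False by (simp add: rho_infty_add_self \<alpha>_def)
      with that show ?thesis
        by (intro eq exI[of _ \<alpha>]) (auto simp: perp_rho_infty_def perp_sip_def)
    qed (simp add: rho_infty_zero_left s_zero)
  qed
  have super: "\<forall>x y. rho_infty x y = cnj (s y x)" if "perp_rho_infty \<supseteq> perp_sip s"
  proof (intro allI)
    fix x y :: 'a
    show "rho_infty x y = cnj (s y x)"
    proof (cases "x = 0")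
      case False
      \<comment> \<open>Now the zero of \<open>s\<close> on the line is chosen, and the reverse
        inclusion transfers it to \<open>rho_infty\<close>.\<close>
      define \<alpha> where "\<alpha> = - s y x / (norm x)\<^sup>2"
      have "s (\<alpha> *\<^sub>C x + y) x = 0"
        using False by (simp add: s_add_self \<alpha>_def)
      with that show ?thesis
        by (intro eq exI[of _ \<alpha>]) (auto simp: perp_rho_infty_def perp_sip_def)
    qed (simp add: rho_infty_zero_left s_zero)
  qed
  \<comment> \<open>Conjugation preserves vanishing, so the identity returns equality of the
    relations and closes the cycle of implications.\<close>
  have "perp_rho_infty = perp_sip s" if "\<forall>x y. rho_infty x y = cnj (s y x)"
    using that by (simp add: perp_rho_infty_def perp_sip_def)
  with sub super show ?thesis by blast
qed

end
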